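(* Let $D$ be a continuous dcpo. (i) If $y$ is a sharp element of $D$, then $\lnot(x\not\sqsubseteq^{+}y)$ implies $x\sqsubseteq y$ for every $x\in D$. In particular, the intrinsic apartness $\#$ on $D$ is tight on sharp elements: for all sharp $x,y\in D$, if $\lnot(x\mathrel{\#}y)$ then $x=y$. (ii) The intrinsic apartness on $D$ is cotransitive with respect to sharp elements in the following sense: for every $x,y\in D$ and every sharp element $z\in D$, if $x\mathrel{\#}y$, then $x\mathrel{\#}z$ or $y\mathrel{\#}z$.
   Context: Everything is constructive: neither excluded middle nor choice is assumed. A subset $S$ of a poset is directed if it is inhabited and any two elements of $S$ have an upper bound in $S$. A dcpo is a poset $(D,\sqsubseteq)$ in which every directed subset $S$ has a supremum $\bigsqcup S$. Write $x\ll y$ ($x$ is way below $y$) if for every directed $S$ with $y\sqsubseteq\bigsqcup S$ there is $s\in S$ with $x\sqsubseteq s$. $D$ is continuous if for every $x$ the set $\{y\in D\mid y\ll x\}$ is directed with supremum $x$. A subset $U\subseteq D$ is Scott open if it is an upper set and whenever $\bigsqcup S\in U$ with $S$ directed, some $s\in S$ is in $U$. Write $x\not\sqsubseteq^{+}y$ if there is a Scott open set containing $x$ but not $y$. The intrinsic apartness is $x\mathrel{\#}y\iff(x\not\sqsubseteq^{+}y)\vee(y\not\sqsubseteq^{+}x)$. An element $x\in D$ is sharp if for every $y,z\in D$ with $y\ll z$ we have $y\ll x$ or $\lnot(z\sqsubseteq x)$. *)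

theory Defs
  imports Main
begin

text \<open>
  The logic of Isabelle/HOL is classical, and under excluded middle every element of a dcpo is
  sharp. To keep the mathematics constructive, all notions are interpreted in the standard
  Heyting-valued semantics of intuitionistic higher-order logic: truth values range over an
  arbitrary complete Heyting algebra, and types are interpreted as sets with Heyting-valued
  equality (the Omega-sets of Fourman and Scott, i.e. the sheaves over that algebra). In general,
  neither excluded middle nor choice is valid in this semantics. For truth values in \<^typ>\<open>bool\<close>
  and ordinary equality, everything reduces to the usual classical notions; see the end of the
  theory.
\<close>

class complete_heyting_algebra = complete_lattice +
  assumes inf_Sup_distrib: "inf a (Sup B) = Sup (inf a ` B)"

abbreviation hand :: "'h::complete_heyting_algebra \<Rightarrow> 'h \<Rightarrow> 'h" (infixr "\<^bold>\<and>" 35)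
  where "a \<^bold>\<and> b \<equiv> inf a b"

abbreviation hor :: "'h::complete_heyting_algebra \<Rightarrow> 'h \<Rightarrow> 'h" (infixr "\<^bold>\<or>" 30)
  where "a \<^bold>\<or> b \<equiv> sup a b"

definition himp :: "'h::complete_heyting_algebra \<Rightarrow> 'h \<Rightarrow> 'h" (infixr "\<^bold>\<longrightarrow>" 25)
  where "(a \<^bold>\<longrightarrow> b) = Sup {c. inf c a \<le> b}"

definition hnot :: "'h::complete_heyting_algebra \<Rightarrow> 'h" ("\<^bold>\<not> _" [40] 40)
  where "(\<^bold>\<not> a) = (a \<^bold>\<longrightarrow> bot)"

definition valid :: "'h::complete_heyting_algebra \<Rightarrow> bool" ("\<Turnstile> _" [5] 5)
  where "(\<Turnstile> a) \<longleftrightarrow> a = top"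

lemma himp_adjoint: "a \<le> (b \<^bold>\<longrightarrow> c) \<longleftrightarrow> inf a b \<le> c"
proof
  assume "a \<le> (b \<^bold>\<longrightarrow> c)"
  then have "inf a b \<le> inf b (Sup {d. inf d b \<le> c})"
    unfolding himp_def by (simp add: le_infI1)
  also have "\<dots> = Sup (inf b ` {d. inf d b \<le> c})"
    by (rule inf_Sup_distrib)
  also have "\<dots> \<le> c"
    by (rule Sup_least) (auto simp: inf.commute)
  finally show "inf a b \<le> c" .
next
  assume "inf a b \<le> c"
  then show "a \<le> (b \<^bold>\<longrightarrow> c)"
    unfolding himp_def by (simp add: Sup_upper)
qed

text \<open>
  Elements of \<^typ>\<open>'a\<close> may exist only partially: the extent of \<open>x\<close> is the truth value
  of \<open>x = x\<close>, and quantifiers over elements are relativised to it. Subsets are the strict and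
  extensional predicates; \<open>S x\<close> is the truth value of \<open>x \<in> S\<close>.
\<close>

record ('a, 'h) hstruct =
  eq :: "'a \<Rightarrow> 'a \<Rightarrow> 'h" (infix "\<approx>\<index>" 50)
  le :: "'a \<Rightarrow> 'a \<Rightarrow> 'h" (infix "\<sqsubseteq>\<index>" 50)

definition extent :: "('a, 'h::complete_heyting_algebra) hstruct \<Rightarrow> 'a \<Rightarrow> 'h"
  where "extent D x = (x \<approx>\<^bsub>D\<^esub> x)"

definition subsets :: "('a, 'h::complete_heyting_algebra) hstruct \<Rightarrow> ('a \<Rightarrow> 'h) set"
  where "subsets D = {S. (\<forall>x. S x \<le> extent D x) \<and> (\<forall>x y. (S x \<^bold>\<and> x \<approx>\<^bsub>D\<^esub> y) \<le> S y)}"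

definition all_el :: "('a, 'h::complete_heyting_algebra) hstruct \<Rightarrow> ('a \<Rightarrow> 'h) \<Rightarrow> 'h"
  where "all_el D P = (INF x. extent D x \<^bold>\<longrightarrow> P x)"

definition ex_el :: "('a, 'h::complete_heyting_algebra) hstruct \<Rightarrow> ('a \<Rightarrow> 'h) \<Rightarrow> 'h"
  where "ex_el D P = (SUP x. extent D x \<^bold>\<and> P x)"

definition all_sub :: "('a, 'h::complete_heyting_algebra) hstruct \<Rightarrow> (('a \<Rightarrow> 'h) \<Rightarrow> 'h) \<Rightarrow> 'h"
  where "all_sub D P = (INF S\<in>subsets D. P S)"

definition ex_sub :: "('a, 'h::complete_heyting_algebra) hstruct \<Rightarrow> (('a \<Rightarrow> 'h) \<Rightarrow> 'h) \<Rightarrow> 'h"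
  where "ex_sub D P = (SUP S\<in>subsets D. P S)"

syntax
  "_all_el" :: "pttrn \<Rightarrow> 'd \<Rightarrow> 'h \<Rightarrow> 'h" ("(3\<^bold>\<forall>_\<in>_./ _)" [0, 51, 10] 10)
  "_ex_el" :: "pttrn \<Rightarrow> 'd \<Rightarrow> 'h \<Rightarrow> 'h" ("(3\<^bold>\<exists>_\<in>_./ _)" [0, 51, 10] 10)
  "_all_sub" :: "pttrn \<Rightarrow> 'd \<Rightarrow> 'h \<Rightarrow> 'h" ("(3\<^bold>\<forall>_\<subseteq>_./ _)" [0, 51, 10] 10)
  "_ex_sub" :: "pttrn \<Rightarrow> 'd \<Rightarrow> 'h \<Rightarrow> 'h" ("(3\<^bold>\<exists>_\<subseteq>_./ _)" [0, 51, 10] 10)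
translations
  "\<^bold>\<forall>x\<in>D. P" \<rightleftharpoons> "CONST all_el D (\<lambda>x. P)"
  "\<^bold>\<exists>x\<in>D. P" \<rightleftharpoons> "CONST ex_el D (\<lambda>x. P)"
  "\<^bold>\<forall>S\<subseteq>D. P" \<rightleftharpoons> "CONST all_sub D (\<lambda>S. P)"
  "\<^bold>\<exists>S\<subseteq>D. P" \<rightleftharpoons> "CONST ex_sub D (\<lambda>S. P)"

text \<open>
  In \<open>hposet\<close>, the first two conjuncts say that equality is Heyting-valued, the next two that the
  order is a relation on the resulting set, and the last three that it is a partial order.
\<close>

definition hposet :: "('a, 'h::complete_heyting_algebra) hstruct \<Rightarrow> bool" where
  "hposet D \<longleftrightarrow>
    (\<forall>x y. (x \<approx>\<^bsub>D\<^esub> y) \<le> (y \<approx>\<^bsub>D\<^esub> x)) \<and>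
    (\<forall>x y z. (x \<approx>\<^bsub>D\<^esub> y \<^bold>\<and> y \<approx>\<^bsub>D\<^esub> z) \<le> (x \<approx>\<^bsub>D\<^esub> z)) \<and>
    (\<forall>x y. (x \<sqsubseteq>\<^bsub>D\<^esub> y) \<le> (extent D x \<^bold>\<and> extent D y)) \<and>
    (\<forall>x x' y y'. (x \<approx>\<^bsub>D\<^esub> x' \<^bold>\<and> y \<approx>\<^bsub>D\<^esub> y' \<^bold>\<and> x \<sqsubseteq>\<^bsub>D\<^esub> y) \<le> (x' \<sqsubseteq>\<^bsub>D\<^esub> y')) \<and>
    (\<Turnstile> \<^bold>\<forall>x\<in>D. x \<sqsubseteq>\<^bsub>D\<^esub> x) \<and>
    (\<Turnstile> \<^bold>\<forall>x\<in>D. \<^bold>\<forall>y\<in>D. \<^bold>\<forall>z\<in>D. x \<sqsubseteq>\<^bsub>D\<^esub> y \<^bold>\<and> y \<sqsubseteq>\<^bsub>D\<^esub> z \<^bold>\<longrightarrow> x \<sqsubseteq>\<^bsub>D\<^esub> z) \<and>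
    (\<Turnstile> \<^bold>\<forall>x\<in>D. \<^bold>\<forall>y\<in>D. x \<sqsubseteq>\<^bsub>D\<^esub> y \<^bold>\<and> y \<sqsubseteq>\<^bsub>D\<^esub> x \<^bold>\<longrightarrow> x \<approx>\<^bsub>D\<^esub> y)"

definition directed :: "('a, 'h::complete_heyting_algebra) hstruct \<Rightarrow> ('a \<Rightarrow> 'h) \<Rightarrow> 'h" where
  "directed D S =
    ((\<^bold>\<exists>x\<in>D. S x) \<^bold>\<and>
     (\<^bold>\<forall>x\<in>D. \<^bold>\<forall>y\<in>D. S x \<^bold>\<and> S y \<^bold>\<longrightarrow> (\<^bold>\<exists>z\<in>D. S z \<^bold>\<and> x \<sqsubseteq>\<^bsub>D\<^esub> z \<^bold>\<and> y \<sqsubseteq>\<^bsub>D\<^esub> z)))"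

definition is_sup :: "('a, 'h::complete_heyting_algebra) hstruct \<Rightarrow> ('a \<Rightarrow> 'h) \<Rightarrow> 'a \<Rightarrow> 'h" where
  "is_sup D S u =
    ((\<^bold>\<forall>x\<in>D. S x \<^bold>\<longrightarrow> x \<sqsubseteq>\<^bsub>D\<^esub> u) \<^bold>\<and>
     (\<^bold>\<forall>v\<in>D. (\<^bold>\<forall>x\<in>D. S x \<^bold>\<longrightarrow> x \<sqsubseteq>\<^bsub>D\<^esub> v) \<^bold>\<longrightarrow> u \<sqsubseteq>\<^bsub>D\<^esub> v))"

definition directed_complete :: "('a, 'h::complete_heyting_algebra) hstruct \<Rightarrow> 'h" where
  "directed_complete D = (\<^bold>\<forall>S\<subseteq>D. directed D S \<^bold>\<longrightarrow> (\<^bold>\<exists>u\<in>D. is_sup D S u))"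

definition way_below :: "('a, 'h::complete_heyting_algebra) hstruct \<Rightarrow> 'a \<Rightarrow> 'a \<Rightarrow> 'h" where
  "way_below D x y =
    (\<^bold>\<forall>S\<subseteq>D. \<^bold>\<forall>u\<in>D. directed D S \<^bold>\<and> is_sup D S u \<^bold>\<and> y \<sqsubseteq>\<^bsub>D\<^esub> u \<^bold>\<longrightarrow> (\<^bold>\<exists>s\<in>D. S s \<^bold>\<and> x \<sqsubseteq>\<^bsub>D\<^esub> s))"

definition way_below_set :: "('a, 'h::complete_heyting_algebra) hstruct \<Rightarrow> 'a \<Rightarrow> 'a \<Rightarrow> 'h" where
  "way_below_set D x = (\<lambda>y. extent D y \<^bold>\<and> way_below D y x)"

definition continuous :: "('a, 'h::complete_heyting_algebra) hstruct \<Rightarrow> 'h" where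
  "continuous D = (\<^bold>\<forall>x\<in>D. directed D (way_below_set D x) \<^bold>\<and> is_sup D (way_below_set D x) x)"

definition continuous_dcpo :: "('a, 'h::complete_heyting_algebra) hstruct \<Rightarrow> bool" where
  "continuous_dcpo D \<longleftrightarrow> hposet D \<and> (\<Turnstile> directed_complete D) \<and> (\<Turnstile> continuous D)"

definition scott_open :: "('a, 'h::complete_heyting_algebra) hstruct \<Rightarrow> ('a \<Rightarrow> 'h) \<Rightarrow> 'h" where
  "scott_open D U =
    ((\<^bold>\<forall>x\<in>D. \<^bold>\<forall>y\<in>D. U x \<^bold>\<and> x \<sqsubseteq>\<^bsub>D\<^esub> y \<^bold>\<longrightarrow> U y) \<^bold>\<and>
     (\<^bold>\<forall>S\<subseteq>D. \<^bold>\<forall>u\<in>D. directed D S \<^bold>\<and> is_sup D S u \<^bold>\<and> U u \<^bold>\<longrightarrow> (\<^bold>\<exists>s\<in>D. S s \<^bold>\<and> U s)))"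

definition not_below_plus :: "('a, 'h::complete_heyting_algebra) hstruct \<Rightarrow> 'a \<Rightarrow> 'a \<Rightarrow> 'h" where
  "not_below_plus D x y = (\<^bold>\<exists>U\<subseteq>D. scott_open D U \<^bold>\<and> U x \<^bold>\<and> \<^bold>\<not> U y)"

definition apart :: "('a, 'h::complete_heyting_algebra) hstruct \<Rightarrow> 'a \<Rightarrow> 'a \<Rightarrow> 'h" where
  "apart D x y = (not_below_plus D x y \<^bold>\<or> not_below_plus D y x)"

definition sharp :: "('a, 'h::complete_heyting_algebra) hstruct \<Rightarrow> 'a \<Rightarrow> 'h" where
  "sharp D x = (\<^bold>\<forall>y\<in>D. \<^bold>\<forall>z\<in>D. way_below D y z \<^bold>\<longrightarrow> way_below D y x \<^bold>\<or> \<^bold>\<not> z \<sqsubseteq>\<^bsub>D\<^esub> x)"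

text \<open>The classical special case.\<close>

instance bool :: complete_heyting_algebra
  by standard auto

lemma bool_connectives [simp]:
  fixes a b :: bool
  shows "(a \<^bold>\<longrightarrow> b) = (a \<longrightarrow> b)" "(\<^bold>\<not> a) = (\<not> a)" "(\<Turnstile> a) = a"
  by (auto simp: himp_def hnot_def valid_def)

lemma bool_quantifiers:
  fixes D :: "('a, bool) hstruct"
  assumes "eq D = (=)"
  shows "(\<^bold>\<forall>x\<in>D. P x) = (\<forall>x. P x)" "(\<^bold>\<exists>x\<in>D. P x) = (\<exists>x. P x)"
    "(\<^bold>\<forall>S\<subseteq>D. Q S) = (\<forall>S. Q S)" "(\<^bold>\<exists>S\<subseteq>D. Q S) = (\<exists>S. Q S)"
  using assms
  by (auto simp: all_el_def ex_el_def all_sub_def ex_sub_def extent_def subsets_def)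

end

theory Submission
  imports Defs
begin

text \<open>
  If \<open>y\<close> is sharp and \<open>u \<lless> v \<lless> x\<close>, then either \<open>u \<lless> y\<close>, or \<open>v\<close> is not below \<open>y\<close>, and then the
  set of elements way above \<open>v\<close>, which is Scott open by interpolation, contains \<open>x\<close> but not \<open>y\<close>.
  For (i), the second case is excluded, so every \<open>u \<lless> x\<close> is below \<open>y\<close>. For (ii), choose such
  \<open>u\<close> and \<open>v\<close> in a Scott open set \<open>U\<close> that separates \<open>x\<close> from another point: in the first case
  the sharp element lies in \<open>U\<close> as well.

  The Heyting-valued semantics is handled by forcing: \<open>p \<le> A\<close> reads ``\<open>p\<close> forces \<open>A\<close>'', and the
  premises of a rule that discharges hypotheses quantify over all stronger conditions \<open>q \<le> p\<close>.
\<close>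

section \<open>Forcing rules\<close>

text \<open>The passage between validity and forcing; the condition \<open>top\<close> recovers
  validity from the right-hand side.\<close>

lemma valid_iff_forced: "(\<Turnstile> a) \<longleftrightarrow> (\<forall>p. p \<le> a)"
  unfolding valid_def by (metis top_greatest top_unique)

lemma forces_impI:
  assumes "\<And>q. q \<le> p \<Longrightarrow> q \<le> a \<Longrightarrow> q \<le> b"
  shows "p \<le> (a \<^bold>\<longrightarrow> b)"
  unfolding himp_adjoint by (rule assms) simp_all

lemma forces_mp:
  assumes "p \<le> (a \<^bold>\<longrightarrow> b)" "p \<le> a"
  shows "p \<le> b"
  using assms unfolding himp_adjoint by (simp add: inf_absorb1)

lemma forces_notI:
  assumes "\<And>q. q \<le> p \<Longrightarrow> q \<le> a \<Longrightarrow> q \<le> bot"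
  shows "p \<le> (\<^bold>\<not> a)"
  unfolding hnot_def using assms by (rule forces_impI)

lemma forces_notE:
  assumes "p \<le> (\<^bold>\<not> a)" "p \<le> a"
  shows "p \<le> c"
  using forces_mp[OF assms[unfolded hnot_def]] by (simp add: bot_unique)

text \<open>The distributive law makes p the join of the pieces \<open>inf p a\<close>, so forcing c
  on each piece forces it at p. The elimination rules for disjunction and for both existential
  quantifiers rest on this covering argument.\<close>

lemma forces_SupE:
  fixes p :: "'h::complete_heyting_algebra"
  assumes "p \<le> Sup A" and "\<And>a. a \<in> A \<Longrightarrow> inf p a \<le> c"
  shows "p \<le> c"
proof -
  have "p = Sup (inf p ` A)"
    using assms(1) by (simp add: inf_Sup_distrib[symmetric] inf_absorb1)
  also have "\<dots> \<le> c"
    using assms(2) by (auto intro: Sup_least)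
  finally show ?thesis .
qed

lemma forces_orE:
  fixes p :: "'h::complete_heyting_algebra"
  assumes "p \<le> (a \<^bold>\<or> b)"
    and "\<And>q. q \<le> p \<Longrightarrow> q \<le> a \<Longrightarrow> q \<le> c"
    and "\<And>q. q \<le> p \<Longrightarrow> q \<le> b \<Longrightarrow> q \<le> c"
  shows "p \<le> c"
proof (rule forces_SupE[of p "{a, b}"])
  show "p \<le> Sup {a, b}"
    using assms(1) by simp
  show "inf p d \<le> c" if "d \<in> {a, b}" for d
    using that assms(2,3) by auto
qed

lemma forces_allI:
  assumes "\<And>x q. q \<le> p \<Longrightarrow> q \<le> extent D x \<Longrightarrow> q \<le> P x"
  shows "p \<le> (\<^bold>\<forall>x\<in>D. P x)"
  unfolding all_el_def by (intro INF_greatest forces_impI assms)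

lemma forces_allD:
  assumes "p \<le> (\<^bold>\<forall>x\<in>D. P x)" "p \<le> extent D x"
  shows "p \<le> P x"
proof -
  have "p \<le> (extent D x \<^bold>\<longrightarrow> P x)"
    using assms(1) unfolding all_el_def by (simp add: le_INF_iff)
  then show ?thesis
    using assms(2) by (rule forces_mp)
qed

lemma forces_exI:
  assumes "p \<le> extent D x" "p \<le> P x"
  shows "p \<le> (\<^bold>\<exists>x\<in>D. P x)"
  unfolding ex_el_def by (rule SUP_upper2[of x]) (simp_all add: assms)

text \<open>A forced existential need not have one witness at p: witnesses appear only on the pieces
  of a cover. As c does not depend on the witness, forcing it on every piece is enough, and no
  witnesses have to be chosen.\<close>

lemma forces_exE:
  assumes "p \<le> (\<^bold>\<exists>x\<in>D. P x)"
    and "\<And>x q. q \<le> p \<Longrightarrow> q \<le> extent D x \<Longrightarrow> q \<le> P x \<Longrightarrow> q \<le> c"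
  shows "p \<le> c"
  using assms(1) unfolding ex_el_def
proof (rule forces_SupE)
  fix a
  assume "a \<in> range (\<lambda>x. extent D x \<^bold>\<and> P x)"
  then obtain x where "a = (extent D x \<^bold>\<and> P x)"
    by blast
  then show "inf p a \<le> c"
    by (intro assms(2)[of _ x]) (simp_all add: le_infI2)
qed

text \<open>Subset quantifiers are plain meets over \<open>subsets D\<close>, without an extent, so
  the condition stays the same, in contrast to \<open>forces_allI\<close>.\<close>

lemma forces_all_subI:
  assumes "\<And>S. S \<in> subsets D \<Longrightarrow> p \<le> P S"
  shows "p \<le> (\<^bold>\<forall>S\<subseteq>D. P S)"
  unfolding all_sub_def by (intro INF_greatest assms)

lemma forces_all_subD:
  assumes "p \<le> (\<^bold>\<forall>S\<subseteq>D. P S)" "S \<in> subsets D"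
  shows "p \<le> P S"
  using assms unfolding all_sub_def by (simp add: le_INF_iff)

lemma forces_ex_subI:
  assumes "S \<in> subsets D" "p \<le> P S"
  shows "p \<le> (\<^bold>\<exists>S\<subseteq>D. P S)"
  unfolding ex_sub_def by (rule SUP_upper2[of S]) (simp_all add: assms)

lemma forces_ex_subE:
  assumes "p \<le> (\<^bold>\<exists>S\<subseteq>D. P S)"
    and "\<And>S q. S \<in> subsets D \<Longrightarrow> q \<le> p \<Longrightarrow> q \<le> P S \<Longrightarrow> q \<le> c"
  shows "p \<le> c"
  using assms(1) unfolding ex_sub_def
proof (rule forces_SupE)
  fix a
  assume "a \<in> P ` subsets D"
  then obtain S where "S \<in> subsets D" "a = P S"
    by blast
  then show "inf p a \<le> c"
    by (intro assms(2)[of S]) simp_all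
qed

section \<open>Directed sets, suprema and the way-below relation\<close>

text \<open>Nested introductions produce a descending chain of conditions. Forcing persists under
  strengthening, so all hypotheses can be moved to the last condition; this rule and the later
  introduction rules hide that bookkeeping.\<close>

lemma directedI:
  assumes "p \<le> (\<^bold>\<exists>x\<in>D. S x)"
    and "\<And>x y q. q \<le> p \<Longrightarrow> q \<le> extent D x \<Longrightarrow> q \<le> extent D y \<Longrightarrow> q \<le> S x \<Longrightarrow> q \<le> S y \<Longrightarrow>
      q \<le> (\<^bold>\<exists>z\<in>D. S z \<^bold>\<and> x \<sqsubseteq>\<^bsub>D\<^esub> z \<^bold>\<and> y \<sqsubseteq>\<^bsub>D\<^esub> z)"
  shows "p \<le> directed D S"
  unfolding directed_def
proof (intro le_infI assms(1) forces_allI forces_impI)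
  fix x y q1 q2 q3
  assume q: "q1 \<le> p" "q2 \<le> q1" "q3 \<le> q2" "q1 \<le> extent D x" "q2 \<le> extent D y"
    and S: "q3 \<le> (S x \<^bold>\<and> S y)"
  have "q3 \<le> p" "q3 \<le> extent D x" "q3 \<le> extent D y"
    using q by (metis order_trans)+
  then show "q3 \<le> (\<^bold>\<exists>z\<in>D. S z \<^bold>\<and> x \<sqsubseteq>\<^bsub>D\<^esub> z \<^bold>\<and> y \<sqsubseteq>\<^bsub>D\<^esub> z)"
    using S by (intro assms(2)) simp_all
qed

lemma directed_inhabited: "p \<le> directed D S \<Longrightarrow> p \<le> (\<^bold>\<exists>x\<in>D. S x)"
  unfolding directed_def by simp

lemma directed_upper_bound:
  assumes "p \<le> directed D S" "p \<le> extent D x" "p \<le> extent D y" "p \<le> S x" "p \<le> S y"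
  shows "p \<le> (\<^bold>\<exists>z\<in>D. S z \<^bold>\<and> x \<sqsubseteq>\<^bsub>D\<^esub> z \<^bold>\<and> y \<sqsubseteq>\<^bsub>D\<^esub> z)"
proof -
  have "p \<le> (\<^bold>\<forall>x\<in>D. \<^bold>\<forall>y\<in>D. S x \<^bold>\<and> S y \<^bold>\<longrightarrow> (\<^bold>\<exists>z\<in>D. S z \<^bold>\<and> x \<sqsubseteq>\<^bsub>D\<^esub> z \<^bold>\<and> y \<sqsubseteq>\<^bsub>D\<^esub> z))"
    using assms(1) unfolding directed_def by simp
  from forces_mp[OF forces_allD[OF forces_allD[OF this assms(2)] assms(3)]] show ?thesis
    using assms(4,5) by simp
qed

lemma is_supI:
  assumes "\<And>x q. q \<le> p \<Longrightarrow> q \<le> extent D x \<Longrightarrow> q \<le> S x \<Longrightarrow> q \<le> (x \<sqsubseteq>\<^bsub>D\<^esub> u)"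
    and "\<And>v q. q \<le> p \<Longrightarrow> q \<le> extent D v \<Longrightarrow>
      (\<And>x r. r \<le> q \<Longrightarrow> r \<le> extent D x \<Longrightarrow> r \<le> S x \<Longrightarrow> r \<le> (x \<sqsubseteq>\<^bsub>D\<^esub> v)) \<Longrightarrow> q \<le> (u \<sqsubseteq>\<^bsub>D\<^esub> v)"
  shows "p \<le> is_sup D S u"
  unfolding is_sup_def
proof (intro le_infI forces_allI forces_impI)
  fix x q1 q2
  assume "q1 \<le> p" "q2 \<le> q1" "q1 \<le> extent D x" "q2 \<le> S x"
  then show "q2 \<le> (x \<sqsubseteq>\<^bsub>D\<^esub> u)"
    by (intro assms(1)) (metis order_trans)+
next
  fix v q1 q2
  assume q: "q1 \<le> p" "q2 \<le> q1" "q1 \<le> extent D v"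
    and ub: "q2 \<le> (\<^bold>\<forall>x\<in>D. S x \<^bold>\<longrightarrow> x \<sqsubseteq>\<^bsub>D\<^esub> v)"
  show "q2 \<le> (u \<sqsubseteq>\<^bsub>D\<^esub> v)"
  proof (rule assms(2))
    show "q2 \<le> p" "q2 \<le> extent D v"
      using q by (metis order_trans)+
    show "r \<le> (x \<sqsubseteq>\<^bsub>D\<^esub> v)" if "r \<le> q2" "r \<le> extent D x" "r \<le> S x" for x r
      by (rule forces_mp[OF forces_allD[OF order_trans[OF that(1) ub] that(2)] that(3)])
  qed
qed

lemma is_sup_upper:
  assumes "p \<le> is_sup D S u" "p \<le> extent D x" "p \<le> S x"
  shows "p \<le> (x \<sqsubseteq>\<^bsub>D\<^esub> u)"
proof -
  have "p \<le> (\<^bold>\<forall>x\<in>D. S x \<^bold>\<longrightarrow> x \<sqsubseteq>\<^bsub>D\<^esub> u)"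
    using assms(1) unfolding is_sup_def by simp
  from forces_mp[OF forces_allD[OF this assms(2)] assms(3)] show ?thesis .
qed

lemma is_sup_least:
  assumes "p \<le> is_sup D S u" "p \<le> extent D v"
    and "\<And>x q. q \<le> p \<Longrightarrow> q \<le> extent D x \<Longrightarrow> q \<le> S x \<Longrightarrow> q \<le> (x \<sqsubseteq>\<^bsub>D\<^esub> v)"
  shows "p \<le> (u \<sqsubseteq>\<^bsub>D\<^esub> v)"
proof -
  have "p \<le> (\<^bold>\<forall>v\<in>D. (\<^bold>\<forall>x\<in>D. S x \<^bold>\<longrightarrow> x \<sqsubseteq>\<^bsub>D\<^esub> v) \<^bold>\<longrightarrow> u \<sqsubseteq>\<^bsub>D\<^esub> v)"
    using assms(1) unfolding is_sup_def by simp
  from forces_allD[OF this assms(2)] show ?thesis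
  proof (rule forces_mp, intro forces_allI forces_impI)
    fix x q1 q2
    assume "q1 \<le> p" "q2 \<le> q1" "q1 \<le> extent D x" "q2 \<le> S x"
    then show "q2 \<le> (x \<sqsubseteq>\<^bsub>D\<^esub> v)"
      by (intro assms(3)) (metis order_trans)+
  qed
qed

lemma way_belowI:
  assumes "\<And>S u q. S \<in> subsets D \<Longrightarrow> q \<le> p \<Longrightarrow> q \<le> extent D u \<Longrightarrow> q \<le> directed D S \<Longrightarrow>
      q \<le> is_sup D S u \<Longrightarrow> q \<le> (y \<sqsubseteq>\<^bsub>D\<^esub> u) \<Longrightarrow> q \<le> (\<^bold>\<exists>s\<in>D. S s \<^bold>\<and> x \<sqsubseteq>\<^bsub>D\<^esub> s)"
  shows "p \<le> way_below D x y"
  unfolding way_below_def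
proof (intro forces_all_subI forces_allI forces_impI)
  fix S u q1 q2
  assume "S \<in> subsets D" and q: "q1 \<le> p" "q2 \<le> q1" "q1 \<le> extent D u"
    and "q2 \<le> (directed D S \<^bold>\<and> is_sup D S u \<^bold>\<and> y \<sqsubseteq>\<^bsub>D\<^esub> u)"
  moreover have "q2 \<le> p" "q2 \<le> extent D u"
    using q by (metis order_trans)+
  ultimately show "q2 \<le> (\<^bold>\<exists>s\<in>D. S s \<^bold>\<and> x \<sqsubseteq>\<^bsub>D\<^esub> s)"
    by (intro assms[of S q2 u]) simp_all
qed

lemma way_belowD:
  assumes "p \<le> way_below D x y" "S \<in> subsets D" "p \<le> extent D u" "p \<le> directed D S"
    "p \<le> is_sup D S u" "p \<le> (y \<sqsubseteq>\<^bsub>D\<^esub> u)"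
  shows "p \<le> (\<^bold>\<exists>s\<in>D. S s \<^bold>\<and> x \<sqsubseteq>\<^bsub>D\<^esub> s)"
  using assms(4-6)
  by (intro forces_mp[OF forces_allD[OF forces_all_subD[OF assms(1)[unfolded way_below_def]
    assms(2)] assms(3)]]) simp

text \<open>The extent conjunct makes the predicate strict. In a Heyting-valued poset,
  \<open>way_below D x y\<close> alone holds vacuously where y does not exist.\<close>

definition way_above_set :: "('a, 'h::complete_heyting_algebra) hstruct \<Rightarrow> 'a \<Rightarrow> 'a \<Rightarrow> 'h"
  where "way_above_set D x = (\<lambda>y. extent D y \<^bold>\<and> way_below D x y)"

section \<open>Scott open sets, sharpness and separation\<close>

lemma scott_openI:
  assumes "\<And>x y q. q \<le> p \<Longrightarrow> q \<le> extent D x \<Longrightarrow> q \<le> extent D y \<Longrightarrow> q \<le> U x \<Longrightarrow>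
      q \<le> (x \<sqsubseteq>\<^bsub>D\<^esub> y) \<Longrightarrow> q \<le> U y"
    and "\<And>S u q. S \<in> subsets D \<Longrightarrow> q \<le> p \<Longrightarrow> q \<le> extent D u \<Longrightarrow> q \<le> directed D S \<Longrightarrow>
      q \<le> is_sup D S u \<Longrightarrow> q \<le> U u \<Longrightarrow> q \<le> (\<^bold>\<exists>s\<in>D. S s \<^bold>\<and> U s)"
  shows "p \<le> scott_open D U"
  unfolding scott_open_def
proof (intro le_infI forces_all_subI forces_allI forces_impI)
  fix x y q1 q2 q3
  assume q: "q1 \<le> p" "q2 \<le> q1" "q3 \<le> q2" "q1 \<le> extent D x" "q2 \<le> extent D y"
    and "q3 \<le> (U x \<^bold>\<and> x \<sqsubseteq>\<^bsub>D\<^esub> y)"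
  moreover have "q3 \<le> p" "q3 \<le> extent D x" "q3 \<le> extent D y"
    using q by (metis order_trans)+
  ultimately show "q3 \<le> U y"
    by (intro assms(1)[of q3 x y]) simp_all
next
  fix S u q1 q2
  assume "S \<in> subsets D" and q: "q1 \<le> p" "q2 \<le> q1" "q1 \<le> extent D u"
    and "q2 \<le> (directed D S \<^bold>\<and> is_sup D S u \<^bold>\<and> U u)"
  moreover have "q2 \<le> p" "q2 \<le> extent D u"
    using q by (metis order_trans)+
  ultimately show "q2 \<le> (\<^bold>\<exists>s\<in>D. S s \<^bold>\<and> U s)"
    by (intro assms(2)[of S q2 u]) simp_all
qed

lemma scott_open_upper:
  assumes "p \<le> scott_open D U" "p \<le> extent D x" "p \<le> extent D y" "p \<le> U x" "p \<le> (x \<sqsubseteq>\<^bsub>D\<^esub> y)"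
  shows "p \<le> U y"
proof -
  have "p \<le> (\<^bold>\<forall>x\<in>D. \<^bold>\<forall>y\<in>D. U x \<^bold>\<and> x \<sqsubseteq>\<^bsub>D\<^esub> y \<^bold>\<longrightarrow> U y)"
    using assms(1) unfolding scott_open_def by simp
  from forces_mp[OF forces_allD[OF forces_allD[OF this assms(2)] assms(3)]] show ?thesis
    using assms(4,5) by simp
qed

lemma scott_open_sup:
  assumes "p \<le> scott_open D U" "S \<in> subsets D" "p \<le> extent D u" "p \<le> directed D S"
    "p \<le> is_sup D S u" "p \<le> U u"
  shows "p \<le> (\<^bold>\<exists>s\<in>D. S s \<^bold>\<and> U s)"
proof -
  have "p \<le> (\<^bold>\<forall>S\<subseteq>D. \<^bold>\<forall>u\<in>D. directed D S \<^bold>\<and> is_sup D S u \<^bold>\<and> U u \<^bold>\<longrightarrow> (\<^bold>\<exists>s\<in>D. S s \<^bold>\<and> U s))"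
    using assms(1) unfolding scott_open_def by simp
  from forces_mp[OF forces_allD[OF forces_all_subD[OF this assms(2)] assms(3)]] show ?thesis
    using assms(4-6) by simp
qed

lemma sharpD:
  assumes "p \<le> sharp D x" "p \<le> extent D y" "p \<le> extent D z" "p \<le> way_below D y z"
  shows "p \<le> (way_below D y x \<^bold>\<or> \<^bold>\<not> z \<sqsubseteq>\<^bsub>D\<^esub> x)"
  using forces_mp[OF forces_allD[OF forces_allD[OF assms(1)[unfolded sharp_def] assms(2)]
    assms(3)] assms(4)] .

lemma not_below_plusI:
  assumes "U \<in> subsets D" "p \<le> scott_open D U" "p \<le> U x" "p \<le> (\<^bold>\<not> U y)"
  shows "p \<le> not_below_plus D x y"
  unfolding not_below_plus_def using assms by (intro forces_ex_subI[of U]) simp_all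

section \<open>Heyting-valued posets\<close>

context
  fixes D :: "('a, 'h::complete_heyting_algebra) hstruct"
  assumes poset: "hposet D"
begin

lemma hposet_le_extent:
  assumes "p \<le> (x \<sqsubseteq>\<^bsub>D\<^esub> y)"
  shows "p \<le> extent D x" "p \<le> extent D y"
proof -
  have "(x \<sqsubseteq>\<^bsub>D\<^esub> y) \<le> (extent D x \<^bold>\<and> extent D y)"
    using poset unfolding hposet_def by blast
  with assms have "p \<le> (extent D x \<^bold>\<and> extent D y)"
    by (rule order_trans)
  then show "p \<le> extent D x" "p \<le> extent D y"
    by simp_all
qed

lemma hposet_refl:
  assumes "p \<le> extent D x"
  shows "p \<le> (x \<sqsubseteq>\<^bsub>D\<^esub> x)"
proof -
  have "p \<le> (\<^bold>\<forall>x\<in>D. x \<sqsubseteq>\<^bsub>D\<^esub> x)"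
    using poset unfolding hposet_def valid_iff_forced by blast
  then show ?thesis
    using assms by (rule forces_allD)
qed

lemma hposet_trans:
  assumes "p \<le> (x \<sqsubseteq>\<^bsub>D\<^esub> y)" "p \<le> (y \<sqsubseteq>\<^bsub>D\<^esub> z)"
  shows "p \<le> (x \<sqsubseteq>\<^bsub>D\<^esub> z)"
proof -
  have "p \<le> (\<^bold>\<forall>x\<in>D. \<^bold>\<forall>y\<in>D. \<^bold>\<forall>z\<in>D. x \<sqsubseteq>\<^bsub>D\<^esub> y \<^bold>\<and> y \<sqsubseteq>\<^bsub>D\<^esub> z \<^bold>\<longrightarrow> x \<sqsubseteq>\<^bsub>D\<^esub> z)"
    using poset unfolding hposet_def valid_iff_forced by blast
  from forces_allD[OF forces_allD[OF forces_allD[OF this]]]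
  have "p \<le> (x \<sqsubseteq>\<^bsub>D\<^esub> y \<^bold>\<and> y \<sqsubseteq>\<^bsub>D\<^esub> z \<^bold>\<longrightarrow> x \<sqsubseteq>\<^bsub>D\<^esub> z)"
    using assms by (blast intro: hposet_le_extent)
  from forces_mp[OF this] show ?thesis
    using assms by simp
qed

lemma hposet_antisym:
  assumes "p \<le> (x \<sqsubseteq>\<^bsub>D\<^esub> y)" "p \<le> (y \<sqsubseteq>\<^bsub>D\<^esub> x)"
  shows "p \<le> (x \<approx>\<^bsub>D\<^esub> y)"
proof -
  have "p \<le> (\<^bold>\<forall>x\<in>D. \<^bold>\<forall>y\<in>D. x \<sqsubseteq>\<^bsub>D\<^esub> y \<^bold>\<and> y \<sqsubseteq>\<^bsub>D\<^esub> x \<^bold>\<longrightarrow> x \<approx>\<^bsub>D\<^esub> y)"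
    using poset unfolding hposet_def valid_iff_forced by blast
  from forces_allD[OF forces_allD[OF this]]
  have "p \<le> (x \<sqsubseteq>\<^bsub>D\<^esub> y \<^bold>\<and> y \<sqsubseteq>\<^bsub>D\<^esub> x \<^bold>\<longrightarrow> x \<approx>\<^bsub>D\<^esub> y)"
    using assms by (blast intro: hposet_le_extent)
  from forces_mp[OF this] show ?thesis
    using assms by simp
qed

lemma hposet_eq_le:
  assumes "p \<le> (x \<approx>\<^bsub>D\<^esub> y)"
  shows "p \<le> (x \<sqsubseteq>\<^bsub>D\<^esub> y)" "p \<le> (y \<sqsubseteq>\<^bsub>D\<^esub> x)"
proof -
  have sym: "(a \<approx>\<^bsub>D\<^esub> b) \<le> (b \<approx>\<^bsub>D\<^esub> a)" for a b
    using poset unfolding hposet_def by blast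
  have trans: "(a \<approx>\<^bsub>D\<^esub> b \<^bold>\<and> b \<approx>\<^bsub>D\<^esub> c) \<le> (a \<approx>\<^bsub>D\<^esub> c)" for a b c
    using poset unfolding hposet_def by blast
  have cong: "(a \<approx>\<^bsub>D\<^esub> a' \<^bold>\<and> b \<approx>\<^bsub>D\<^esub> b' \<^bold>\<and> a \<sqsubseteq>\<^bsub>D\<^esub> b) \<le> (a' \<sqsubseteq>\<^bsub>D\<^esub> b')" for a a' b b'
    using poset unfolding hposet_def by blast
  \<comment> \<open>Symmetry and transitivity make x exist, so x \<sqsubseteq> x is available;
    congruence then replaces either side by y.\<close>
  have yx: "p \<le> (y \<approx>\<^bsub>D\<^esub> x)"
    using assms sym by (rule order_trans)
  have xx: "p \<le> (x \<approx>\<^bsub>D\<^esub> x)"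
    using assms yx by (intro order_trans[OF _ trans[of x y x]]) simp
  have le: "p \<le> (x \<sqsubseteq>\<^bsub>D\<^esub> x)"
    using xx by (intro hposet_refl) (simp add: extent_def)
  show "p \<le> (x \<sqsubseteq>\<^bsub>D\<^esub> y)"
    using assms xx le by (intro order_trans[OF _ cong[of x x x y]]) simp
  show "p \<le> (y \<sqsubseteq>\<^bsub>D\<^esub> x)"
    using assms xx le by (intro order_trans[OF _ cong[of x y x x]]) simp
qed

text \<open>Equal elements lie below each other, so invariance under mutual inequality implies
  extensionality. For sets defined by way-below this reduces extensionality to monotonicity.\<close>

lemma subsetsI:
  assumes "\<And>x. S x \<le> extent D x"
    and "\<And>x y q. q \<le> S x \<Longrightarrow> q \<le> (x \<sqsubseteq>\<^bsub>D\<^esub> y) \<Longrightarrow> q \<le> (y \<sqsubseteq>\<^bsub>D\<^esub> x) \<Longrightarrow> q \<le> S y"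
  shows "S \<in> subsets D"
proof -
  have "(S x \<^bold>\<and> x \<approx>\<^bsub>D\<^esub> y) \<le> S y" for x y
    by (rule assms(2)[of _ x]) (simp_all add: hposet_eq_le)
  then show ?thesis
    using assms(1) unfolding subsets_def by blast
qed

section \<open>Monotonicity of the way-below relation\<close>

lemma way_below_mono_left:
  assumes "p \<le> (x' \<sqsubseteq>\<^bsub>D\<^esub> x)" "p \<le> way_below D x y"
  shows "p \<le> way_below D x' y"
proof (rule way_belowI)
  fix S u q
  assume S: "S \<in> subsets D" and qp: "q \<le> p"
    and q: "q \<le> extent D u" "q \<le> directed D S" "q \<le> is_sup D S u" "q \<le> (y \<sqsubseteq>\<^bsub>D\<^esub> u)"
  note h = assms[THEN order_trans[OF qp]]
  from h(2) S q show "q \<le> (\<^bold>\<exists>s\<in>D. S s \<^bold>\<and> x' \<sqsubseteq>\<^bsub>D\<^esub> s)"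
  proof (rule way_belowD[THEN forces_exE])
    fix s r
    assume rq: "r \<le> q" and r: "r \<le> extent D s" "r \<le> (S s \<^bold>\<and> x \<sqsubseteq>\<^bsub>D\<^esub> s)"
    have "r \<le> (x' \<sqsubseteq>\<^bsub>D\<^esub> s)"
      using h(1)[THEN order_trans[OF rq]] r(2) by (intro hposet_trans[of r x' x s]) simp_all
    with r show "r \<le> (\<^bold>\<exists>s\<in>D. S s \<^bold>\<and> x' \<sqsubseteq>\<^bsub>D\<^esub> s)"
      by (intro forces_exI[of r D s]) simp_all
  qed
qed

lemma way_below_mono_right:
  assumes "p \<le> way_below D x y" "p \<le> (y \<sqsubseteq>\<^bsub>D\<^esub> y')"
  shows "p \<le> way_below D x y'"
proof (rule way_belowI)
  fix S u q
  assume S: "S \<in> subsets D" and qp: "q \<le> p"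
    and q: "q \<le> extent D u" "q \<le> directed D S" "q \<le> is_sup D S u" "q \<le> (y' \<sqsubseteq>\<^bsub>D\<^esub> u)"
  note h = assms[THEN order_trans[OF qp]]
  from h(1) S q(1-3) hposet_trans[OF h(2) q(4)]
  show "q \<le> (\<^bold>\<exists>s\<in>D. S s \<^bold>\<and> x \<sqsubseteq>\<^bsub>D\<^esub> s)"
    by (rule way_belowD)
qed

lemma way_below_set_subset: "way_below_set D x \<in> subsets D"
  unfolding way_below_set_def
  by (rule subsetsI) (auto intro: hposet_le_extent way_below_mono_left)

lemma way_above_set_subset: "way_above_set D x \<in> subsets D"
  unfolding way_above_set_def
  by (rule subsetsI) (auto intro: hposet_le_extent way_below_mono_right)

end

section \<open>Continuous dcpos\<close>

context
  fixes D :: "('a, 'h::complete_heyting_algebra) hstruct"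
  assumes continuous_dcpo: "continuous_dcpo D"
begin

lemma dcpo_hposet: "hposet D"
  using continuous_dcpo unfolding continuous_dcpo_def by blast

lemmas dcpo_le_extent = hposet_le_extent[OF dcpo_hposet]
lemmas dcpo_trans = hposet_trans[OF dcpo_hposet]
lemmas dcpo_refl = hposet_refl[OF dcpo_hposet]

lemma
  assumes "p \<le> extent D x"
  shows way_below_set_directed: "p \<le> directed D (way_below_set D x)"
    and way_below_set_is_sup: "p \<le> is_sup D (way_below_set D x) x"
proof -
  have "p \<le> continuous D"
    using continuous_dcpo unfolding continuous_dcpo_def valid_iff_forced by blast
  from forces_allD[OF this[unfolded continuous_def] assms]
  show "p \<le> directed D (way_below_set D x)" "p \<le> is_sup D (way_below_set D x) x"
    by simp_all
qed

section \<open>Order and interpolation for the way-below relation\<close>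

lemma way_below_imp_le:
  assumes "p \<le> extent D x" "p \<le> extent D y" "p \<le> way_below D x y"
  shows "p \<le> (x \<sqsubseteq>\<^bsub>D\<^esub> y)"
  \<comment> \<open>By continuity y is the supremum of the elements way below it, and x is one of
    them.\<close>
  using way_below_set_is_sup[OF assms(2)] assms(1)
  by (rule is_sup_upper) (simp add: way_below_set_def assms)

text \<open>The set consists of all a with a \<lless> b \<lless> y for some b; note that
  \<open>way_below_set D y b\<close> says that b is way below y. It is directed with supremum y, so
  testing x \<lless> y against it produces an interpolant.\<close>

lemma interpolants_subset:
  "(\<lambda>a. \<^bold>\<exists>b\<in>D. way_below_set D y b \<^bold>\<and> way_below_set D b a) \<in> subsets D" (is "?S \<in> _")
proof (rule subsetsI[OF dcpo_hposet])
  show "?S a \<le> extent D a" for a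
    by (rule forces_exE[OF order_refl]) (simp add: way_below_set_def)
  fix a a' q
  assume qS: "q \<le> ?S a" and aa: "q \<le> (a \<sqsubseteq>\<^bsub>D\<^esub> a')" and a'a: "q \<le> (a' \<sqsubseteq>\<^bsub>D\<^esub> a)"
  from qS show "q \<le> ?S a'"
  proof (rule forces_exE)
    fix b r
    assume r: "r \<le> q" "r \<le> extent D b" "r \<le> (way_below_set D y b \<^bold>\<and> way_below_set D b a)"
    note a = aa[THEN order_trans[OF r(1)]] a'a[THEN order_trans[OF r(1)]]
    have "r \<le> way_below D a' b"
      using a(2) by (rule way_below_mono_left[OF dcpo_hposet]) (use r in \<open>simp add: way_below_set_def\<close>)
    then show "r \<le> ?S a'"
      using r dcpo_le_extent(2)[OF a(1)]
      by (intro forces_exI[of r D b]) (simp_all add: way_below_set_def)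
  qed
qed

text \<open>Directedness of the way-below sets is used on two levels: first below y to bound the
  intermediate elements, then below that bound.\<close>

lemma interpolants_directed:
  assumes "p \<le> extent D y"
  shows "p \<le> directed D (\<lambda>a. \<^bold>\<exists>b\<in>D. way_below_set D y b \<^bold>\<and> way_below_set D b a)"
    (is "_ \<le> directed D ?S")
proof (rule directedI)
  show "p \<le> (\<^bold>\<exists>a\<in>D. ?S a)"
    using directed_inhabited[OF way_below_set_directed[OF assms]]
  proof (rule forces_exE)
    fix b q
    assume b: "q \<le> p" "q \<le> extent D b" "q \<le> way_below_set D y b"
    show "q \<le> (\<^bold>\<exists>a\<in>D. ?S a)"
      using directed_inhabited[OF way_below_set_directed[OF b(2)]]
    proof (rule forces_exE)
      fix a r
      assume a: "r \<le> q" "r \<le> extent D a" "r \<le> way_below_set D b a"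
      note b' = b(2,3)[THEN order_trans[OF a(1)]]
      have "r \<le> ?S a"
        using a b' by (intro forces_exI[of r D b]) simp_all
      with a(2) show "r \<le> (\<^bold>\<exists>a\<in>D. ?S a)"
        by (rule forces_exI)
    qed
  qed
next
  fix a1 a2 q
  assume qp: "q \<le> p" and a: "q \<le> extent D a1" "q \<le> extent D a2" and S: "q \<le> ?S a1" "q \<le> ?S a2"
  let ?bound = "\<^bold>\<exists>a\<in>D. ?S a \<^bold>\<and> a1 \<sqsubseteq>\<^bsub>D\<^esub> a \<^bold>\<and> a2 \<sqsubseteq>\<^bsub>D\<^esub> a"
  from S(1) show "q \<le> ?bound"
  proof (rule forces_exE)
    fix b1 q1
    assume q1: "q1 \<le> q" and b1: "q1 \<le> extent D b1"
      "q1 \<le> (way_below_set D y b1 \<^bold>\<and> way_below_set D b1 a1)"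
    from S(2)[THEN order_trans[OF q1]] show "q1 \<le> ?bound"
    proof (rule forces_exE)
      fix b2 q2
      assume q2: "q2 \<le> q1" and b2: "q2 \<le> extent D b2"
        "q2 \<le> (way_below_set D y b2 \<^bold>\<and> way_below_set D b2 a2)"
      note b1' = b1[THEN order_trans[OF q2]]
      have ey: "q2 \<le> extent D y"
        using assms qp q1 q2 by (metis order_trans)
      \<comment> \<open>A common upper bound b of the two intermediate elements, still way below
        y.\<close>
      have "q2 \<le> (\<^bold>\<exists>b\<in>D. way_below_set D y b \<^bold>\<and> b1 \<sqsubseteq>\<^bsub>D\<^esub> b \<^bold>\<and> b2 \<sqsubseteq>\<^bsub>D\<^esub> b)"
        using b1' b2 by (intro directed_upper_bound way_below_set_directed ey) simp_all
      then show "q2 \<le> ?bound"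
      proof (rule forces_exE)
        fix b q3
        assume q3: "q3 \<le> q2" and b: "q3 \<le> extent D b"
          "q3 \<le> (way_below_set D y b \<^bold>\<and> b1 \<sqsubseteq>\<^bsub>D\<^esub> b \<^bold>\<and> b2 \<sqsubseteq>\<^bsub>D\<^esub> b)"
        have le: "q3 \<le> (b1 \<sqsubseteq>\<^bsub>D\<^esub> b)" "q3 \<le> (b2 \<sqsubseteq>\<^bsub>D\<^esub> b)"
          using b by simp_all
        have wb: "q3 \<le> way_below D a1 b1" "q3 \<le> way_below D a2 b2"
          using b1'(2)[THEN order_trans[OF q3]] b2(2)[THEN order_trans[OF q3]]
          by (simp_all add: way_below_set_def)
        have ea: "q3 \<le> extent D a1" "q3 \<le> extent D a2"
          using a q1 q2 q3 by (metis order_trans)+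
        \<comment> \<open>Since b1 and b2 lie below b, both a1 and a2 are way below the same b. They
          therefore have an upper bound c that is again way below b, and b witnesses that c is in
          the set.\<close>
        have "q3 \<le> way_below_set D b a1" "q3 \<le> way_below_set D b a2"
          using way_below_mono_right[OF dcpo_hposet wb(1) le(1)]
            way_below_mono_right[OF dcpo_hposet wb(2) le(2)] ea
          by (simp_all add: way_below_set_def)
        from directed_upper_bound[OF way_below_set_directed[OF b(1)] ea this]
        show "q3 \<le> ?bound"
        proof (rule forces_exE)
          fix c q4
          assume q4: "q4 \<le> q3" and c: "q4 \<le> extent D c"
            "q4 \<le> (way_below_set D b c \<^bold>\<and> a1 \<sqsubseteq>\<^bsub>D\<^esub> c \<^bold>\<and> a2 \<sqsubseteq>\<^bsub>D\<^esub> c)"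
          note b' = b[THEN order_trans[OF q4]]
          have "q4 \<le> ?S c"
            using b' c by (intro forces_exI[of q4 D b]) simp_all
          then show "q4 \<le> ?bound"
            using c by (intro forces_exI[of q4 D c]) simp_all
        qed
      qed
    qed
  qed
qed

text \<open>For leastness, continuity is applied twice: an upper bound v lies above every a \<lless>
  b, hence above b; this holds for every b \<lless> y, hence v lies above y.\<close>

lemma interpolants_is_sup:
  assumes "p \<le> extent D y"
  shows "p \<le> is_sup D (\<lambda>a. \<^bold>\<exists>b\<in>D. way_below_set D y b \<^bold>\<and> way_below_set D b a) y"
    (is "_ \<le> is_sup D ?S y")
proof (rule is_supI)
  fix a q
  assume q: "q \<le> p" and a: "q \<le> extent D a" "q \<le> ?S a"
  from a(2) show "q \<le> (a \<sqsubseteq>\<^bsub>D\<^esub> y)"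
  proof (rule forces_exE)
    fix b r
    assume r: "r \<le> q" and b: "r \<le> extent D b" "r \<le> (way_below_set D y b \<^bold>\<and> way_below_set D b a)"
    have e: "r \<le> extent D y" "r \<le> extent D a"
      using assms q r a(1) by (metis order_trans)+
    show "r \<le> (a \<sqsubseteq>\<^bsub>D\<^esub> y)"
      using b e by (intro dcpo_trans[of r a b y] way_below_imp_le) (simp_all add: way_below_set_def)
  qed
next
  fix v q
  assume q: "q \<le> p" and v: "q \<le> extent D v"
    and ub: "\<And>a r. r \<le> q \<Longrightarrow> r \<le> extent D a \<Longrightarrow> r \<le> ?S a \<Longrightarrow> r \<le> (a \<sqsubseteq>\<^bsub>D\<^esub> v)"
  from way_below_set_is_sup[OF order_trans[OF q assms]] v show "q \<le> (y \<sqsubseteq>\<^bsub>D\<^esub> v)"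
  proof (rule is_sup_least)
    fix b r
    assume r: "r \<le> q" and b: "r \<le> extent D b" "r \<le> way_below_set D y b"
    from way_below_set_is_sup[OF b(1)] order_trans[OF r v] show "r \<le> (b \<sqsubseteq>\<^bsub>D\<^esub> v)"
    proof (rule is_sup_least)
      fix a t
      assume t: "t \<le> r" and a: "t \<le> extent D a" "t \<le> way_below_set D b a"
      note b' = b[THEN order_trans[OF t]]
      have "t \<le> ?S a"
        using a b' by (intro forces_exI[of t D b]) simp_all
      then show "t \<le> (a \<sqsubseteq>\<^bsub>D\<^esub> v)"
        using order_trans[OF t r] a(1) by (intro ub)
    qed
  qed
qed

text \<open>Applying x \<lless> y to the directed set above gives s with x \<sqsubseteq> s and s
  \<lless> b \<lless> y for some b. Then x \<lless> b, so b interpolates.\<close>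

lemma way_below_interpolate:
  assumes "p \<le> extent D x" "p \<le> extent D y" "p \<le> way_below D x y"
  shows "p \<le> (\<^bold>\<exists>z\<in>D. way_below D x z \<^bold>\<and> way_below D z y)"
  using assms(3) interpolants_subset assms(2) interpolants_directed[OF assms(2)]
    interpolants_is_sup[OF assms(2)] dcpo_refl[OF assms(2)]
proof (rule way_belowD[THEN forces_exE])
  fix s q
  assume "q \<le> p" "q \<le> extent D s"
    and s: "q \<le> ((\<^bold>\<exists>b\<in>D. way_below_set D y b \<^bold>\<and> way_below_set D b s) \<^bold>\<and> x \<sqsubseteq>\<^bsub>D\<^esub> s)"
  have le: "q \<le> (x \<sqsubseteq>\<^bsub>D\<^esub> s)"
    using s by simp
  have "q \<le> (\<^bold>\<exists>b\<in>D. way_below_set D y b \<^bold>\<and> way_below_set D b s)"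
    using s by simp
  then show "q \<le> (\<^bold>\<exists>z\<in>D. way_below D x z \<^bold>\<and> way_below D z y)"
  proof (rule forces_exE)
    fix b r
    assume r: "r \<le> q" and b: "r \<le> extent D b" "r \<le> (way_below_set D y b \<^bold>\<and> way_below_set D b s)"
    have "r \<le> way_below D x b"
      using order_trans[OF r le] by (rule way_below_mono_left[OF dcpo_hposet])
        (use b in \<open>simp add: way_below_set_def\<close>)
    then show "r \<le> (\<^bold>\<exists>z\<in>D. way_below D x z \<^bold>\<and> way_below D z y)"
      using b by (intro forces_exI[of r D b]) (simp_all add: way_below_set_def)
  qed
qed

text \<open>If u is the supremum of S and x \<lless> u, interpolate x \<lless> z \<lless> u. Some s
  in S lies above z, and x \<lless> z \<sqsubseteq> s gives x \<lless> s.\<close>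

lemma way_above_set_scott_open:
  assumes "p \<le> extent D x"
  shows "p \<le> scott_open D (way_above_set D x)"
proof (rule scott_openI)
  fix y z q
  assume "q \<le> extent D z" "q \<le> way_above_set D x y" "q \<le> (y \<sqsubseteq>\<^bsub>D\<^esub> z)"
  then show "q \<le> way_above_set D x z"
    unfolding way_above_set_def by (auto intro: way_below_mono_right[OF dcpo_hposet])
next
  fix S u q
  assume S: "S \<in> subsets D" and q: "q \<le> p" and u: "q \<le> extent D u"
    and dir: "q \<le> directed D S" and sup: "q \<le> is_sup D S u" and xu: "q \<le> way_above_set D x u"
  have "q \<le> (\<^bold>\<exists>z\<in>D. way_below D x z \<^bold>\<and> way_below D z u)"
    using xu by (intro way_below_interpolate order_trans[OF q assms] u)
      (simp add: way_above_set_def)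
  then show "q \<le> (\<^bold>\<exists>s\<in>D. S s \<^bold>\<and> way_above_set D x s)"
  proof (rule forces_exE)
    fix z r
    assume r: "r \<le> q" and z: "r \<le> extent D z" "r \<le> (way_below D x z \<^bold>\<and> way_below D z u)"
    note h = u[THEN order_trans[OF r]] dir[THEN order_trans[OF r]] sup[THEN order_trans[OF r]]
    have "r \<le> (\<^bold>\<exists>s\<in>D. S s \<^bold>\<and> z \<sqsubseteq>\<^bsub>D\<^esub> s)"
      using z(2) by (intro way_belowD[OF _ S h dcpo_refl[OF h(1)]]) simp
    then show "r \<le> (\<^bold>\<exists>s\<in>D. S s \<^bold>\<and> way_above_set D x s)"
    proof (rule forces_exE)
      fix s t
      assume t: "t \<le> r" and s: "t \<le> extent D s" "t \<le> (S s \<^bold>\<and> z \<sqsubseteq>\<^bsub>D\<^esub> s)"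
      have "t \<le> way_below D x s"
        using order_trans[OF t z(2)] s(2) by (intro way_below_mono_right[OF dcpo_hposet, of t x z s]) simp_all
      then show "t \<le> (\<^bold>\<exists>s\<in>D. S s \<^bold>\<and> way_above_set D x s)"
        using s by (intro forces_exI[of t D s]) (simp_all add: way_above_set_def)
    qed
  qed
qed

section \<open>Sharp elements: separation, tightness and cotransitivity\<close>

lemma way_below_not_le_imp_not_below_plus:
  assumes "p \<le> extent D v" "p \<le> extent D x" "p \<le> extent D y"
    and "p \<le> way_below D v x" "p \<le> (\<^bold>\<not> v \<sqsubseteq>\<^bsub>D\<^esub> y)"
  shows "p \<le> not_below_plus D x y"
proof (rule not_below_plusI)
  \<comment> \<open>The separating open set is the set of elements way above v. It contains x, and
    it cannot contain y because v \<lless> y would give v \<sqsubseteq> y.\<close>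
  show "way_above_set D v \<in> subsets D"
    by (rule way_above_set_subset[OF dcpo_hposet])
  show "p \<le> scott_open D (way_above_set D v)"
    by (rule way_above_set_scott_open[OF assms(1)])
  show "p \<le> way_above_set D v x"
    using assms by (simp add: way_above_set_def)
  show "p \<le> (\<^bold>\<not> way_above_set D v y)"
  proof (rule forces_notI)
    fix q
    assume q: "q \<le> p" "q \<le> way_above_set D v y"
    have "q \<le> (v \<sqsubseteq>\<^bsub>D\<^esub> y)"
      using assms(1,3)[THEN order_trans[OF q(1)]] q(2)
      by (intro way_below_imp_le) (simp_all add: way_above_set_def)
    with order_trans[OF q(1) assms(5)] show "q \<le> bot"
      by (rule forces_notE)
  qed
qed

text \<open>The common core of both parts of the theorem: sharpness of y is tested on u \<lless> v,
  where v interpolates u \<lless> x. The alternative u \<lless> y is weakened to u \<sqsubseteq> y,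
  which is all that the applications use.\<close>

lemma sharp_way_below_cases:
  assumes "p \<le> extent D u" "p \<le> extent D x" "p \<le> extent D y"
    and "p \<le> way_below D u x" "p \<le> sharp D y"
  shows "p \<le> (u \<sqsubseteq>\<^bsub>D\<^esub> y \<^bold>\<or> not_below_plus D x y)"
  using way_below_interpolate[OF assms(1,2,4)]
proof (rule forces_exE)
  fix v q
  assume q: "q \<le> p" and v: "q \<le> extent D v" "q \<le> (way_below D u v \<^bold>\<and> way_below D v x)"
  note h = assms[THEN order_trans[OF q]]
  have "q \<le> (way_below D u y \<^bold>\<or> \<^bold>\<not> v \<sqsubseteq>\<^bsub>D\<^esub> y)"
    using v(2) by (intro sharpD[OF h(5,1) v(1)]) simp
  then show "q \<le> (u \<sqsubseteq>\<^bsub>D\<^esub> y \<^bold>\<or> not_below_plus D x y)"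
  proof (rule forces_orE)
    fix r
    assume r: "r \<le> q" "r \<le> way_below D u y"
    have "r \<le> (u \<sqsubseteq>\<^bsub>D\<^esub> y)"
      using r(2) by (intro way_below_imp_le h(1,3)[THEN order_trans[OF r(1)]])
    then show "r \<le> (u \<sqsubseteq>\<^bsub>D\<^esub> y \<^bold>\<or> not_below_plus D x y)"
      by (rule le_supI1)
  next
    fix r
    assume r: "r \<le> q" "r \<le> (\<^bold>\<not> v \<sqsubseteq>\<^bsub>D\<^esub> y)"
    have "r \<le> not_below_plus D x y"
      using order_trans[OF r(1) v(2)] r(2)
      by (intro way_below_not_le_imp_not_below_plus[of r v]
        order_trans[OF r(1) v(1)] h(2,3)[THEN order_trans[OF r(1)]]) simp_all
    then show "r \<le> (u \<sqsubseteq>\<^bsub>D\<^esub> y \<^bold>\<or> not_below_plus D x y)"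
      by (rule le_supI2)
  qed
qed

lemma sharp_not_not_below_plus_imp_le:
  assumes "p \<le> extent D x" "p \<le> extent D y" "p \<le> sharp D y" "p \<le> (\<^bold>\<not> not_below_plus D x y)"
  shows "p \<le> (x \<sqsubseteq>\<^bsub>D\<^esub> y)"
  using way_below_set_is_sup[OF assms(1)] assms(2)
proof (rule is_sup_least)
  fix u q
  assume q: "q \<le> p" and u: "q \<le> extent D u" "q \<le> way_below_set D x u"
  note h = assms[THEN order_trans[OF q]]
  have "q \<le> (u \<sqsubseteq>\<^bsub>D\<^esub> y \<^bold>\<or> not_below_plus D x y)"
    using u(2) by (intro sharp_way_below_cases u(1) h) (simp add: way_below_set_def)
  then show "q \<le> (u \<sqsubseteq>\<^bsub>D\<^esub> y)"
  \<comment> \<open>The first alternative is the goal itself and is discharged by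
    \<open>qed\<close>; the second contradicts the hypothesis.\<close>
  proof (rule forces_orE)
    fix r
    assume r: "r \<le> q" "r \<le> not_below_plus D x y"
    from order_trans[OF r(1) h(4)] r(2) show "r \<le> (u \<sqsubseteq>\<^bsub>D\<^esub> y)"
      by (rule forces_notE)
  qed
qed

text \<open>A negated disjunction negates both disjuncts. Sharpness of y then gives x \<sqsubseteq>
  y, sharpness of x gives y \<sqsubseteq> x, and antisymmetry finishes.\<close>

lemma sharp_apart_tight:
  assumes "p \<le> extent D x" "p \<le> extent D y" "p \<le> sharp D x" "p \<le> sharp D y"
    and "p \<le> (\<^bold>\<not> apart D x y)"
  shows "p \<le> (x \<approx>\<^bsub>D\<^esub> y)"
proof -
  have "p \<le> (\<^bold>\<not> not_below_plus D x y)" "p \<le> (\<^bold>\<not> not_below_plus D y x)"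
    by (rule forces_notI, rule forces_notE[OF order_trans[OF _ assms(5)]],
      assumption, simp add: apart_def le_supI1 le_supI2)+
  then show ?thesis
    using assms by (intro hposet_antisym[OF dcpo_hposet] sharp_not_not_below_plus_imp_le)
qed

text \<open>The one-sided form of cotransitivity; the symmetric form follows by applying it to each
  disjunct of apartness.\<close>

lemma not_below_plus_cotransitive:
  assumes "p \<le> extent D x" "p \<le> extent D y" "p \<le> extent D z" "p \<le> sharp D z"
    and "p \<le> not_below_plus D x y"
  shows "p \<le> (not_below_plus D x z \<^bold>\<or> not_below_plus D z y)"
  using assms(5) unfolding not_below_plus_def[of D x y]
proof (rule forces_ex_subE)
  fix U q
  assume U: "U \<in> subsets D" and q: "q \<le> p"
    and open_sep: "q \<le> (scott_open D U \<^bold>\<and> U x \<^bold>\<and> \<^bold>\<not> U y)"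
  note h = assms[THEN order_trans[OF q]]
  have "q \<le> scott_open D U" "q \<le> U x"
    using open_sep by simp_all
  \<comment> \<open>As x is the directed supremum of the elements way below it and lies in U, some u
    \<lless> x already lies in U.\<close>
  from scott_open_sup[OF this(1) way_below_set_subset[OF dcpo_hposet] h(1)
      way_below_set_directed[OF h(1)] way_below_set_is_sup[OF h(1)] this(2)]
  show "q \<le> (not_below_plus D x z \<^bold>\<or> not_below_plus D z y)"
  proof (rule forces_exE)
    fix u r
    assume r: "r \<le> q" and u: "r \<le> extent D u" "r \<le> (way_below_set D x u \<^bold>\<and> U u)"
    note h = h[THEN order_trans[OF r]]
    have "r \<le> (u \<sqsubseteq>\<^bsub>D\<^esub> z \<^bold>\<or> not_below_plus D x z)"
      using u(2) by (intro sharp_way_below_cases u(1) h) (simp add: way_below_set_def)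
    then show "r \<le> (not_below_plus D x z \<^bold>\<or> not_below_plus D z y)"
    proof (rule forces_orE)
      fix t
      assume t: "t \<le> r" "t \<le> (u \<sqsubseteq>\<^bsub>D\<^esub> z)"
      have sep: "t \<le> (scott_open D U \<^bold>\<and> U x \<^bold>\<and> \<^bold>\<not> U y)"
        using open_sep r t(1) by (metis order_trans)
      \<comment> \<open>U is an upper set containing u, so it contains z, and the same U now
        separates z from y.\<close>
      have "t \<le> U z"
        using sep order_trans[OF t(1) u(2)] t(2) dcpo_le_extent[OF t(2)]
        by (intro scott_open_upper[of t D U u z]) simp_all
      then have "t \<le> not_below_plus D z y"
        using sep by (intro not_below_plusI[OF U]) simp_all
      then show "t \<le> (not_below_plus D x z \<^bold>\<or> not_below_plus D z y)"
        by (rule le_supI2)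
    qed (rule le_supI1)
  qed
qed

lemma apart_cotransitive:
  assumes "p \<le> extent D x" "p \<le> extent D y" "p \<le> extent D z" "p \<le> sharp D z" "p \<le> apart D x y"
  shows "p \<le> (apart D x z \<^bold>\<or> apart D y z)"
  using assms(5) unfolding apart_def[of D x y]
proof (rule forces_orE)
  fix q
  assume q: "q \<le> p" "q \<le> not_below_plus D x y"
  have "q \<le> (not_below_plus D x z \<^bold>\<or> not_below_plus D z y)"
    using q(2) by (intro not_below_plus_cotransitive assms(1-4)[THEN order_trans[OF q(1)]])
  then show "q \<le> (apart D x z \<^bold>\<or> apart D y z)"
    unfolding apart_def by (rule order_trans) (simp add: le_supI1 le_supI2)
next
  fix q
  \<comment> \<open>The same argument with x and y exchanged.\<close>
  assume q: "q \<le> p" "q \<le> not_below_plus D y x"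
  have "q \<le> (not_below_plus D y z \<^bold>\<or> not_below_plus D z x)"
    using q(2) by (intro not_below_plus_cotransitive assms(1-4)[THEN order_trans[OF q(1)]])
  then show "q \<le> (apart D x z \<^bold>\<or> apart D y z)"
    unfolding apart_def by (rule order_trans) (simp add: le_supI1 le_supI2)
qed

end

theorem theorem5p15:
  fixes D :: "('a, 'h::complete_heyting_algebra) hstruct"
  assumes "continuous_dcpo D"
  shows "(\<Turnstile> \<^bold>\<forall>y\<in>D. sharp D y \<^bold>\<longrightarrow> (\<^bold>\<forall>x\<in>D. \<^bold>\<not> not_below_plus D x y \<^bold>\<longrightarrow> x \<sqsubseteq>\<^bsub>D\<^esub> y))
    \<and> (\<Turnstile> \<^bold>\<forall>x\<in>D. \<^bold>\<forall>y\<in>D. sharp D x \<^bold>\<and> sharp D y \<^bold>\<longrightarrow> \<^bold>\<not> apart D x y \<^bold>\<longrightarrow> x \<approx>\<^bsub>D\<^esub> y)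
    \<and> (\<Turnstile> \<^bold>\<forall>x\<in>D. \<^bold>\<forall>y\<in>D. \<^bold>\<forall>z\<in>D. sharp D z \<^bold>\<longrightarrow> apart D x y \<^bold>\<longrightarrow> apart D x z \<^bold>\<or> apart D y z)"
  unfolding valid_iff_forced
\<comment> \<open>Each quantifier or implication introduces its own stronger condition; transitivity
  carries all hypotheses to the last one, where the forcing lemmas apply.\<close>
proof (intro conjI allI forces_allI forces_impI)
  fix p y q1 q2 x q3 q4
  assume "q2 \<le> q1" "q3 \<le> q2" "q4 \<le> q3" "q1 \<le> extent D y" "q2 \<le> sharp D y" "q3 \<le> extent D x"
    and "q4 \<le> (\<^bold>\<not> not_below_plus D x y)"
  then show "q4 \<le> (x \<sqsubseteq>\<^bsub>D\<^esub> y)"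
    by (intro sharp_not_not_below_plus_imp_le[OF assms]) (metis order_trans)+
next
  fix p x q1 y q2 q3 q4
  assume "q2 \<le> q1" "q3 \<le> q2" "q4 \<le> q3" "q1 \<le> extent D x" "q2 \<le> extent D y"
    and "q3 \<le> (sharp D x \<^bold>\<and> sharp D y)" and "q4 \<le> (\<^bold>\<not> apart D x y)"
  then show "q4 \<le> (x \<approx>\<^bsub>D\<^esub> y)"
    unfolding le_inf_iff by (intro sharp_apart_tight[OF assms]) (metis order_trans)+
next
  fix p x q1 y q2 z q3 q4 q5
  assume "q2 \<le> q1" "q3 \<le> q2" "q4 \<le> q3" "q5 \<le> q4" "q1 \<le> extent D x" "q2 \<le> extent D y"
    "q3 \<le> extent D z" and "q4 \<le> sharp D z" and "q5 \<le> apart D x y"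
  then show "q5 \<le> (apart D x z \<^bold>\<or> apart D y z)"
    by (intro apart_cotransitive[OF assms]) (metis order_trans)+
qed

end
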